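(* Let $L_n$ denote the Lucas numbers. For every non-negative integer $m$, $$\frac32\sum_{k=-\lfloor m/3\rfloor}^{\lfloor m/3\rfloor}\binom{2m}{m-3k}=2^{2m-1}+1,$$ $$\frac32\sum_{k=-\left\lfloor\frac{m+2}3\right\rfloor}^{\left\lfloor\frac{m-1}3\right\rfloor}\binom{2m+1}{m-3k-1}=3\sum_{k=0}^{\left\lfloor\frac{m-1}3\right\rfloor}\binom{2m+1}{m-3k-1}=4^m-1,$$ $$L_{2m}=-2^{2m-1}+\frac52\sum_{k=-\lfloor m/5\rfloor}^{\lfloor m/5\rfloor}\binom{2m}{m-5k},$$ $$L_{2m+1}=4^m-\frac52\sum_{k=-\left\lfloor\frac{m+3}5\right\rfloor}^{\left\lfloor\frac{m-2}5\right\rfloor}\binom{2m+1}{m-5k-2}.$$ For every positive integer $n$, $$2\sum_{k=0}^{\lfloor (n+1)/2\rfloor}\binom{2k-n-1}{k}-\sum_{k=0}^{\lfloor n/2\rfloor}\binom{2k-n}{k}=\begin{cases}(-1)^{n-1}&(3\nmid n)\\(-1)^n2&(3\mid n),\end{cases}$$ $$2\sum_{k=0}^{\lfloor (n+1)/2\rfloor}\binom{2k-n-1}{k}L_{n-2k}-\sum_{k=0}^{\lfloor n/2\rfloor}\binom{2k-n}{k}L_{n-2k}=\begin{cases}(-1)^{n-1}&(5\nmid n)\\(-1)^n4&(5\mid n).\end{cases}$$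
   Context: $L_n=\left(\frac{1+\sqrt5}2\right)^n+\left(\frac{1-\sqrt5}2\right)^n$ are the Lucas numbers ($L_0=2,L_1=1$; $L_{-1}=-1$, which only occurs with coefficient $0$). For an integer $n$ (possibly negative), $\binom nk=\frac{n(n-1)\cdots(n-k+1)}{k!}$ for $k\ge1$ and $\binom n0=1$. Sums whose upper limit is smaller than their lower limit are empty; $\lfloor x\rfloor$ is the greatest integer not exceeding $x$. *)

theory Defs
  imports Complex_Main
begin

text \<open>The index is an integer because the term at index \<open>- 1\<close> occurs (with coefficient \<open>0\<close>) in the
  sums below; \<open>lucas_rec\<close> and the initial values confirm that these are the Lucas numbers.\<close>

definition lucas :: "int \<Rightarrow> real" where
  "lucas n = ((1 + sqrt 5) / 2) powi n + ((1 - sqrt 5) / 2) powi n"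

lemma lucas_0: "lucas 0 = 2"
  by (simp add: lucas_def)

lemma lucas_1: "lucas 1 = 1"
  by (simp add: lucas_def field_simps)

lemma lucas_rec: "lucas (n + 2) = lucas (n + 1) + lucas n"
proof -
  have *: "x powi (n + 2) = x powi (n + 1) + x powi n" if "x * x = x + 1" for x :: real
  proof -
    have "x \<noteq> 0" using that by auto
    then have "x powi (n + 2) = x powi n * (x * x)" "x powi (n + 1) = x powi n * x"
      by (simp_all add: power_int_add power2_eq_square)
    then show ?thesis by (simp add: that algebra_simps)
  qed
  show ?thesis unfolding lucas_def
    by (subst (1 2) *) (simp_all add: field_simps)
qed

lemma lucas_minus_1: "lucas (- 1) = - 1"
  using lucas_rec[of "- 1"] by (simp add: lucas_0 lucas_1)

text \<open>Integer division rounds towards minus infinity, so \<open>a div d\<close> on \<open>int\<close> is the floor of the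
  quotient also for negative \<open>a\<close>.\<close>

lemma int_div_is_floor: "(a :: int) div d = \<lfloor>real_of_int a / real_of_int d\<rfloor>"
  by (simp add: floor_divide_of_int_eq)

end

theory Submission
  imports Defs
begin

text \<open>
  Both groups of identities are the same finite Fourier analysis on the integers modulo \<open>d\<close>, for
  \<open>d = 3\<close> and \<open>d = 5\<close>.

  The four window sums collect the binomial coefficients \<open>N choose j\<close> with \<open>j\<close> in one residue class
  modulo \<open>d\<close>, namely the class that contains \<open>N / 2\<close>: since \<open>d\<close> is odd, it is described by
  \<open>d dvd 2 * j - N\<close> (\<open>window_sum_eq_residue_sum\<close>). Expanding the indicator of this condition into
  cosines (\<open>sum_cos_residues\<close>) and using the binomial expansion of a power of a cosine,
  \<open>(2 cos t)^N = \<Sum>j. (N choose j) cos ((2j - N) t)\<close>, gives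
  \<open>d * \<Sum>j. (N choose j) = \<Sum>r<d. (2 cos (2 pi r / d))^N\<close> (\<open>sum_choose_residue\<close>).
  For \<open>d = 3\<close> the bases on the right are \<open>2, -1, -1\<close>. For \<open>d = 5\<close> they are \<open>2\<close> and, twice each, the
  negatives of the golden ratio and of its conjugate, so that \<open>2^N + 2 (-1)^N lucas N\<close> appears.

  In the two alternating identities the coefficient \<open>(2k - n - 1) gchoose k\<close> is
  \<open>(-1)^k (n - k choose k)\<close>, a coefficient of the Chebyshev polynomial \<open>S_n\<close> for which
  \<open>sin t * S_n (2 cos t) = sin ((n + 1) t)\<close>. The combination on the left-hand side is
  \<open>2 S_n - y S_(n-1)\<close>, whose value at \<open>y = 2 cos t\<close> is \<open>2 cos (n t)\<close> (\<open>cheb_S_cos\<close>). The evaluation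
  points are the same numbers as before up to sign: \<open>1 = - 2 cos (2 pi / 3)\<close> for the plain sums, and
  the golden ratio and its conjugate, \<open>- 2 cos (4 pi / 5)\<close> and \<open>- 2 cos (2 pi / 5)\<close>, for the sums
  weighted by Lucas numbers. The sign turns into the factor \<open>(-1)^n\<close>, and what remains is the character
  sum \<open>\<Sum>r. cos (2 pi r n / d)\<close> over the nonzero residues \<open>r\<close> modulo \<open>d\<close>;
  it takes the value \<open>d - 1\<close> or \<open>- 1\<close> according to whether \<open>d\<close> divides \<open>n\<close>.
\<close>

section \<open>Binomial coefficients in a residue class\<close>

text \<open>The real part of the binomial expansion of \<open>(cis t + cis (- t)) ^ N\<close>.\<close>

lemma cos_power_eq_sum_choose:
  "(2 * cos t) ^ N = (\<Sum>j\<le>N. real (N choose j) * cos ((2 * real j - real N) * t))"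
proof -
  have "cis t + cis (- t) = complex_of_real (2 * cos t)"
    by (simp add: complex_eq_iff)
  then have "complex_of_real ((2 * cos t) ^ N) = (cis t + cis (- t)) ^ N"
    by simp
  also have "\<dots> = (\<Sum>j\<le>N. of_nat (N choose j) * cis t ^ j * cis (- t) ^ (N - j))"
    by (rule binomial_ring)
  also have "\<dots> = (\<Sum>j\<le>N. of_nat (N choose j) * cis ((2 * real j - real N) * t))"
    by (intro sum.cong) (auto simp: DeMoivre cis_mult mult.assoc of_nat_diff algebra_simps)
  finally show ?thesis
    by (simp add: complex_eq_iff del: of_real_power)
qed

text \<open>The real part of a geometric sum: its ratio is a \<open>d\<close>-th root of unity, which equals \<open>1\<close> exactly
  when \<open>d\<close> divides \<open>x\<close>.\<close>

lemma sum_cos_residues: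
  fixes x :: int
  assumes "0 < d"
  shows "(\<Sum>r<d. cos (2 * pi * real r * of_int x / real d)) = (if int d dvd x then real d else 0)"
proof -
  define z where "z = cis (2 * pi * of_int x / real d)"
  have power: "z ^ r = cis (2 * pi * real r * of_int x / real d)" for r
    by (simp add: z_def DeMoivre mult_ac)
  have sum: "(\<Sum>r<d. cos (2 * pi * real r * of_int x / real d)) = Re (\<Sum>r<d. z ^ r)"
    by (simp add: power)
  show ?thesis
  proof (cases "int d dvd x")
    case True
    then obtain q where "x = int d * q" ..
    then have "2 * pi * of_int x / real d = 2 * pi * of_int q"
      using assms by simp
    then have "z = 1"
      by (simp only: z_def cis_multiple_2pi Ints_of_int)
    then show ?thesis using True by (simp add: sum)
  next
    case False
    have "z \<noteq> 1"
    proof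
      assume "z = 1"
      then have "cos (2 * pi * of_int x / real d) = 1"
        by (simp add: z_def complex_eq_iff)
      then obtain q :: int where "2 * pi * of_int x / real d = of_int q * 2 * pi"
        by (auto simp: cos_one_2pi_int)
      then have "real_of_int x = real_of_int (int d * q)"
        using assms by (simp add: field_simps)
      then have "x = int d * q" by linarith
      then show False using False by simp
    qed
    moreover have "z ^ d = 1"
    proof -
      have "2 * pi * real d * of_int x / real d = 2 * pi * of_int x"
        using assms by simp
      then show ?thesis
        by (simp only: power cis_multiple_2pi Ints_of_int)
    qed
    ultimately have "(\<Sum>r<d. z ^ r) = 0"
      by (simp add: geometric_sum)
    then show ?thesis using False by (simp add: sum)
  qed
qed

lemma cos_reflected_residue:
  fixes x :: int
  assumes "r \<le> d" "0 < d"
  shows "cos (2 * pi * real (d - r) * of_int x / real d) = cos (2 * pi * real r * of_int x / real d)"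
proof -
  have "2 * pi * real (d - r) * of_int x / real d
      = 2 * pi * of_int x - 2 * pi * real r * of_int x / real d"
    using assms by (simp add: of_nat_diff field_simps)
  then show ?thesis
    by (simp add: cos_diff)
qed

text \<open>For odd \<open>d\<close> the residues \<open>r\<close> and \<open>d - r\<close> give equal cosines, so every sum over all residues folds
  into the term at \<open>0\<close> and a doubled half. The arbitrary \<open>g\<close> serves two purposes below: the identity
  yields the character sums, and a power yields the sums of binomial coefficients.\<close>

lemma sum_residues_3:
  fixes x :: int and g :: "real \<Rightarrow> real"
  shows "(\<Sum>r<3. g (cos (2 * pi * real r * of_int x / 3))) = g 1 + 2 * g (cos (2 * pi * of_int x / 3))"
proof -
  define h where "h r = g (cos (2 * pi * real r * of_int x / 3))" for r :: nat
  have "h 2 = h 1"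
    using cos_reflected_residue[of 1 3 x] by (simp add: h_def)
  moreover have "(\<Sum>r<3. h r) = h 0 + h 1 + h 2"
    by (simp add: eval_nat_numeral lessThan_Suc)
  ultimately show ?thesis by (simp add: h_def)
qed

lemma sum_residues_5:
  fixes x :: int and g :: "real \<Rightarrow> real"
  shows "(\<Sum>r<5. g (cos (2 * pi * real r * of_int x / 5)))
    = g 1 + 2 * g (cos (2 * pi * of_int x / 5)) + 2 * g (cos (4 * pi * of_int x / 5))"
proof -
  define h where "h r = g (cos (2 * pi * real r * of_int x / 5))" for r :: nat
  have "h 4 = h 1" "h 3 = h 2"
    using cos_reflected_residue[of 1 5 x] cos_reflected_residue[of 2 5 x] by (simp_all add: h_def)
  moreover have "(\<Sum>r<5. h r) = h 0 + h 1 + h 2 + h 3 + h 4"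
    by (simp add: eval_nat_numeral lessThan_Suc)
  ultimately have "(\<Sum>r<5. h r) = h 0 + 2 * h 1 + 2 * h 2" by simp
  then show ?thesis by (simp add: h_def)
qed

lemma cos_character_3:
  fixes x :: int
  shows "2 * cos (2 * pi * of_int x / 3) = (if 3 dvd x then 2 else - 1)"
  using sum_cos_residues[of 3 x] sum_residues_3[of "\<lambda>c. c" x] by (simp split: if_splits)

lemma cos_character_5:
  fixes x :: int
  shows "2 * cos (2 * pi * of_int x / 5) + 2 * cos (4 * pi * of_int x / 5)
    = (if 5 dvd x then 4 else - 1)"
  using sum_cos_residues[of 5 x] sum_residues_5[of "\<lambda>c. c" x] by (simp split: if_splits)

text \<open>Replace the indicator of \<open>d dvd 2 * j - N\<close> by its cosine expansion and exchange the two sums; the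
  inner sum over \<open>j\<close> is then the expansion of a power of a cosine.\<close>

lemma sum_choose_residue:
  assumes "0 < d"
  shows "real d * (\<Sum>j | j \<le> N \<and> int d dvd 2 * int j - int N. real (N choose j))
    = (\<Sum>r<d. (2 * cos (2 * pi * real r / real d)) ^ N)"
proof -
  have "real d * (\<Sum>j | j \<le> N \<and> int d dvd 2 * int j - int N. real (N choose j))
      = (\<Sum>j\<le>N. real (N choose j) * (if int d dvd 2 * int j - int N then real d else 0))"
    by (simp add: sum_distrib_left mult.commute if_distrib[of "\<lambda>u. _ * u"] sum.If_cases
        Collect_conj_eq atMost_def cong: if_cong)
  also have "\<dots> = (\<Sum>j\<le>N. \<Sum>r<d.
      real (N choose j) * cos ((2 * real j - real N) * (2 * pi * real r / real d)))"
    unfolding sum_cos_residues[OF assms, symmetric] sum_distrib_left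
    by (intro sum.cong refl) (simp add: mult_ac)
  also have "\<dots> = (\<Sum>r<d. (2 * cos (2 * pi * real r / real d)) ^ N)"
    unfolding cos_power_eq_sum_choose by (rule sum.swap)
  finally show ?thesis .
qed

text \<open>The bounds on \<open>k\<close> say precisely that \<open>j = a - d * k\<close> lies between \<open>0\<close> and \<open>N\<close>, so \<open>j\<close> runs through
  the residue class of \<open>a\<close> in that range. As \<open>2 * a\<close> is congruent to \<open>N\<close> and \<open>2\<close> is invertible modulo
  \<open>d\<close>, this class is the solution set of \<open>2 * j = N\<close> modulo \<open>d\<close>.\<close>

lemma window_sum_eq_residue_sum:
  fixes a :: int
  assumes d: "odd d" and a: "int d dvd 2 * a - int N"
  shows "(\<Sum>k = - ((int N - a) div int d)..a div int d. f (nat (a - int d * k)))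
    = (\<Sum>j | j \<le> N \<and> int d dvd 2 * int j - int N. f j)"
proof -
  have "d > 0" using d by (rule odd_pos)
  have le_div: "l \<le> b div int d \<longleftrightarrow> int d * l \<le> b" for l b
  proof -
    have "l \<le> b div int d \<longleftrightarrow> real_of_int (int d * l) \<le> real_of_int b"
      using \<open>d > 0\<close> by (simp add: int_div_is_floor le_floor_iff pos_le_divide_eq mult.commute)
    then show ?thesis by (simp only: of_int_le_iff)
  qed
  have window: "k \<in> {- ((int N - a) div int d)..a div int d}
      \<longleftrightarrow> 0 \<le> a - int d * k \<and> a - int d * k \<le> int N" for k
    using le_div[of "- k" "int N - a"] le_div[of k a] by auto
  have residue: "int d dvd 2 * j - int N \<longleftrightarrow> int d dvd a - j" for j
  proof -
    have "int d dvd 2 * j - int N \<longleftrightarrow> int d dvd (2 * a - int N) - 2 * (a - j)"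
      by (simp add: algebra_simps)
    also have "\<dots> \<longleftrightarrow> int d dvd 2 * (a - j)"
      by (rule dvd_diff_right_iff[OF a])
    also have "\<dots> \<longleftrightarrow> int d dvd a - j"
      by (rule coprime_dvd_mult_right_iff) (use d in simp)
    finally show ?thesis .
  qed
  show ?thesis
  proof (rule sum.reindex_bij_witness[of _
        "\<lambda>j. (a - int j) div int d" "\<lambda>k. nat (a - int d * k)"])
    fix j assume "j \<in> {j. j \<le> N \<and> int d dvd 2 * int j - int N}"
    then have "j \<le> N" and "int d * ((a - int j) div int d) = a - int j"
      by (auto simp: residue)
    then show "nat (a - int d * ((a - int j) div int d)) = j"
      and "(a - int j) div int d \<in> {- ((int N - a) div int d)..a div int d}"
      unfolding window by simp_all
  qed (use \<open>d > 0\<close> in \<open>auto simp: window residue simp del: atLeastAtMost_iff\<close>)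
qed

section \<open>The golden ratio as a cosine\<close>

text \<open>The character sum modulo \<open>5\<close> and the double-angle formula give \<open>c + (c\<^sup>2 - 2) = - 1\<close> for
  \<open>c = 2 * cos (2 * pi / 5)\<close>; positivity selects the root of this quadratic equation.\<close>

lemma cos_72_144:
  "2 * cos (2 * pi / 5) = - ((1 - sqrt 5) / 2)"
  "2 * cos (4 * pi / 5) = - ((1 + sqrt 5) / 2)"
proof -
  define c where "c = 2 * cos (2 * pi / 5)"
  have "c > 0"
    unfolding c_def by (intro mult_pos_pos cos_gt_zero) auto
  have double: "2 * cos (4 * pi / 5) = c\<^sup>2 - 2"
    using cos_double_cos[of "2 * pi / 5"] by (simp add: c_def power2_eq_square)
  have sum: "c + 2 * cos (4 * pi / 5) = - 1"
    using cos_character_5[of 1] by (simp add: c_def)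
  have "(2 * c + 1)\<^sup>2 = 5"
    using double sum by (simp add: power2_eq_square algebra_simps)
  then have "2 * c + 1 = sqrt 5"
    using \<open>c > 0\<close> by (simp add: real_sqrt_unique)
  then show "2 * cos (2 * pi / 5) = - ((1 - sqrt 5) / 2)"
    and "2 * cos (4 * pi / 5) = - ((1 + sqrt 5) / 2)"
    using sum by (simp_all add: c_def field_simps)
qed

lemma lucas_of_nat: "lucas (int n) = (- 1) ^ n * ((2 * cos (2 * pi / 5)) ^ n + (2 * cos (4 * pi / 5)) ^ n)"
proof -
  have "(- 1) ^ n * (- x) ^ n = x ^ n" for x :: real
    by (simp flip: power_mult_distrib)
  then show ?thesis
    by (simp only: cos_72_144 distrib_left) (simp add: lucas_def)
qed

lemma sum_choose_residue_3:
  "3 * (\<Sum>j | j \<le> N \<and> 3 dvd 2 * int j - int N. real (N choose j)) = 2 ^ N + 2 * (- 1) ^ N"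
proof -
  have "2 * cos (2 * pi / 3) = - 1"
    using cos_character_3[of 1] by simp
  then show ?thesis
    using sum_choose_residue[of 3 N] sum_residues_3[of "\<lambda>c. (2 * c) ^ N" 1]
    by (simp del: power_mult_distrib)
qed

lemma sum_choose_residue_5:
  "5 * (\<Sum>j | j \<le> N \<and> 5 dvd 2 * int j - int N. real (N choose j))
    = 2 ^ N + 2 * (- 1) ^ N * lucas (int N)"
proof -
  have "(- 1) ^ N * lucas (int N) = (2 * cos (2 * pi / 5)) ^ N + (2 * cos (4 * pi / 5)) ^ N"
    unfolding lucas_of_nat by (simp add: left_minus_one_mult_self)
  then show ?thesis
    using sum_choose_residue[of 5 N] sum_residues_5[of "\<lambda>c. (2 * c) ^ N" 1]
    by (simp del: power_mult_distrib)
qed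

section \<open>The four central window sums\<close>

text \<open>The reflection \<open>k \<mapsto> - 1 - k\<close> turns \<open>j = m - 3 * k - 1\<close> into \<open>2 * m + 1 - j\<close>, which leaves the
  binomial coefficient unchanged and exchanges the negative indices with the others.\<close>

lemma half_window_sum:
  "(\<Sum>k = - ((int m + 2) div 3)..(int m - 1) div 3. real ((2 * m + 1) choose nat (int m - 3 * k - 1)))
    = 2 * (\<Sum>k = 0..(int m - 1) div 3. real ((2 * m + 1) choose nat (int m - 3 * k - 1)))"
proof -
  define h where "h k = real ((2 * m + 1) choose nat (int m - 3 * k - 1))" for k
  define q where "q = (int m - 1) div 3"
  have q: "(int m + 2) div 3 = q + 1" "- 1 \<le> q"
    unfolding q_def by linarith+
  have mirror: "h (- 1 - k) = h k" if "k \<in> {0..q}" for k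
  proof -
    have "3 * k + 1 \<le> int m" "0 \<le> k"
      using that unfolding q_def by auto
    then have "nat (int m - 3 * (- 1 - k) - 1) = (2 * m + 1) - nat (int m - 3 * k - 1)"
      and "nat (int m - 3 * k - 1) \<le> 2 * m + 1"
      by (simp_all add: nat_diff_distrib' nat_add_distrib algebra_simps)
    then show ?thesis
      unfolding h_def by (metis binomial_symmetric)
  qed
  have "(\<Sum>k = 0..q. h k) = (\<Sum>k = - (q + 1)..- 1. h k)"
    by (rule sum.reindex_bij_witness[of _ "\<lambda>k. - 1 - k" "\<lambda>k. - 1 - k"])
      (auto simp: mirror)
  moreover have "{- (q + 1)..q} = {- (q + 1)..- 1} \<union> {0..q}"
    using q(2) by auto
  then have "(\<Sum>k = - (q + 1)..q. h k) = (\<Sum>k = - (q + 1)..- 1. h k) + (\<Sum>k = 0..q. h k)"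
    by (simp add: sum.union_disjoint)
  ultimately show ?thesis
    unfolding h_def q(1) q_def[symmetric] by simp
qed

lemma window_sum_3_even:
  "3 / 2 * (\<Sum>k = - (int m div 3)..int m div 3. real ((2 * m) choose nat (int m - 3 * k)))
    = 2 powi (2 * int m - 1) + 1"
  using window_sum_eq_residue_sum[of 3 "int m" "2 * m" "\<lambda>j. real ((2 * m) choose j)"]
    sum_choose_residue_3[of "2 * m"]
  by (simp add: power_int_diff power_int_mult power_mult)

lemma window_sum_3_odd:
  "3 / 2 * (\<Sum>k = - ((int m + 2) div 3)..(int m - 1) div 3.
      real ((2 * m + 1) choose nat (int m - 3 * k - 1))) = 4 ^ m - 1"
  using window_sum_eq_residue_sum[of 3 "int m - 1" "2 * m + 1" "\<lambda>j. real ((2 * m + 1) choose j)"]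
    sum_choose_residue_3[of "2 * m + 1"]
  by (simp add: power_mult diff_diff_eq add.commute)

lemma window_sum_5_even:
  "lucas (2 * int m) = - (2 powi (2 * int m - 1))
    + 5 / 2 * (\<Sum>k = - (int m div 5)..int m div 5. real ((2 * m) choose nat (int m - 5 * k)))"
  using window_sum_eq_residue_sum[of 5 "int m" "2 * m" "\<lambda>j. real ((2 * m) choose j)"]
    sum_choose_residue_5[of "2 * m"]
  by (simp add: power_int_diff power_int_mult power_mult add_divide_distrib)

lemma window_sum_5_odd:
  "lucas (2 * int m + 1) = 4 ^ m
    - 5 / 2 * (\<Sum>k = - ((int m + 3) div 5)..(int m - 2) div 5.
        real ((2 * m + 1) choose nat (int m - 5 * k - 2)))"
  using window_sum_eq_residue_sum[of 5 "int m - 2" "2 * m + 1" "\<lambda>j. real ((2 * m + 1) choose j)"]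
    sum_choose_residue_5[of "2 * m + 1"]
  by (simp add: power_mult diff_diff_eq add.commute diff_divide_distrib)

section \<open>Alternating diagonal sums\<close>

text \<open>The Chebyshev polynomials of the second kind rescaled to the argument \<open>y = 2 * cos t\<close>. The
  summands with \<open>2 * k > n\<close>, where the subtraction in the exponent is truncated, have coefficient \<open>0\<close>;
  admitting them spares a parity distinction in the recurrence.\<close>

definition cheb_S :: "nat \<Rightarrow> real \<Rightarrow> real" where
  "cheb_S n y = (\<Sum>k\<le>n. (- 1) ^ k * real ((n - k) choose k) * y ^ (n - 2 * k))"

lemma cheb_S_0: "cheb_S 0 y = 1" and cheb_S_1: "cheb_S (Suc 0) y = y"
  by (simp_all add: cheb_S_def)

text \<open>Pascal's rule for \<open>n + 1 - k choose k + 1\<close>, with the terms of \<open>cheb_S n\<close> shifted by one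
  index; the index \<open>k = 0\<close> has no such partner and is split off.\<close>

lemma cheb_S_Suc_Suc: "cheb_S (Suc (Suc n)) y = y * cheb_S (Suc n) y - cheb_S n y"
proof -
  let ?t = "\<lambda>n k. (- 1) ^ k * real ((n - k) choose k) * y ^ (n - 2 * k)"
  \<comment> \<open>If \<open>2 * k > n + 1\<close>, the truncated exponents do not match, but then the coefficient is \<open>0\<close>.\<close>
  have low: "y * ?t (Suc n) k = (- 1) ^ k * real ((Suc n - k) choose k) * y ^ (Suc (Suc n) - 2 * k)"
    for k
  proof (cases "2 * k \<le> Suc n")
    case True
    then show ?thesis by (simp add: Suc_diff_le)
  next
    case False
    then have "Suc n - k < k" by linarith
    then show ?thesis by (simp add: binomial_eq_0)
  qed
  have pascal: "?t (Suc (Suc n)) (Suc k) = y * ?t (Suc n) (Suc k) - ?t n k" if "k \<le> n" for k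
    using that unfolding low by (simp add: Suc_diff_le algebra_simps)
  have "cheb_S (Suc (Suc n)) y = (\<Sum>k\<le>Suc n. ?t (Suc (Suc n)) k)"
    by (simp add: cheb_S_def)
  also have "\<dots> = y ^ Suc (Suc n) + (\<Sum>k\<le>n. ?t (Suc (Suc n)) (Suc k))"
    by (simp only: sum.atMost_Suc_shift) simp
  also have "\<dots> = y ^ Suc (Suc n) + (\<Sum>k\<le>n. y * ?t (Suc n) (Suc k) - ?t n k)"
    using pascal by simp
  also have "\<dots> = y * (y ^ Suc n + (\<Sum>k\<le>n. ?t (Suc n) (Suc k))) - cheb_S n y"
    by (simp add: cheb_S_def sum_subtractf sum_distrib_left algebra_simps)
  also have "y ^ Suc n + (\<Sum>k\<le>n. ?t (Suc n) (Suc k)) = cheb_S (Suc n) y"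
    unfolding cheb_S_def by (simp only: sum.atMost_Suc_shift) simp
  finally show ?thesis .
qed

text \<open>Both sides satisfy the recurrence of \<open>cheb_S\<close> in \<open>n\<close>. Arguing through the recurrence instead
  of through quotients of sines covers the zeros of \<open>sin t\<close>.\<close>

lemma cheb_S_cos:
  "2 * cheb_S (Suc n) (2 * cos t) - 2 * cos t * cheb_S n (2 * cos t) = 2 * cos (real (Suc n) * t)"
proof (induction n rule: induct_nat_012)
  case 0
  show ?case by (simp add: cheb_S_0 cheb_S_1)
next
  case 1
  show ?case
    using cos_double_cos[of t] by (simp add: cheb_S_0 cheb_S_1 cheb_S_Suc_Suc power2_eq_square)
next
  case (ge2 n)
  have "cos (real (Suc (Suc (Suc n))) * t)
      = 2 * cos t * cos (real (Suc (Suc n)) * t) - cos (real (Suc n) * t)"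
    using cos_add[of "real (Suc (Suc n)) * t" t] cos_diff[of "real (Suc (Suc n)) * t" t]
    by (simp add: algebra_simps)
  then show ?case
    using ge2 by (simp add: cheb_S_Suc_Suc[of "Suc n"] cheb_S_Suc_Suc[of n] algebra_simps)
qed

text \<open>Upper negation turns the coefficient into \<open>(- 1) ^ k * (n - k choose k)\<close>. For odd \<open>n\<close> the last
  index of the left-hand sum has exponent \<open>- 1\<close>, and its coefficient is \<open>0\<close>.\<close>

lemma diagonal_gbinomial_sum:
  assumes "y \<noteq> 0"
  shows "(\<Sum>k = 0..(n + 1) div 2. ((2 * real k - real n - 1) gchoose k) * y powi (int n - 2 * int k))
    = cheb_S n y"
proof -
  have "(\<Sum>k = 0..(n + 1) div 2. ((2 * real k - real n - 1) gchoose k) * y powi (int n - 2 * int k))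
      = (\<Sum>k = 0..(n + 1) div 2. (- 1) ^ k * real ((n - k) choose k) * y ^ (n - 2 * k))"
  proof (rule sum.cong)
    fix k assume "k \<in> {0..(n + 1) div 2}"
    then have k: "k \<le> n" by auto
    have "(2 * real k - real n - 1) gchoose k = (- 1) ^ k * (real (n - k) gchoose k)"
      using k gbinomial_negated_upper[of "2 * real k - real n - 1" k]
      by (simp add: of_nat_diff algebra_simps)
    also have "\<dots> = (- 1) ^ k * real ((n - k) choose k)"
      by (simp add: binomial_gbinomial)
    finally have coeff: "(2 * real k - real n - 1) gchoose k = (- 1) ^ k * real ((n - k) choose k)" .
    show "((2 * real k - real n - 1) gchoose k) * y powi (int n - 2 * int k)
        = (- 1) ^ k * real ((n - k) choose k) * y ^ (n - 2 * k)"
    proof (cases "2 * k \<le> n")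
      case True
      then have "int n - 2 * int k = int (n - 2 * k)" by simp
      then show ?thesis by (simp only: coeff power_int_of_nat)
    next
      case False
      then have "n - k < k" using k by linarith
      then show ?thesis by (simp add: coeff binomial_eq_0)
    qed
  qed simp
  also have "\<dots> = cheb_S n y"
    unfolding cheb_S_def
    by (rule sum.mono_neutral_left) auto
  finally show ?thesis .
qed

text \<open>With \<open>y = - 2 * cos t = 2 * cos (t + pi)\<close>, the second sum is \<open>y\<close> times the first one for \<open>n - 1\<close>,
  so the difference is \<open>2 * cheb_S n y - y * cheb_S (n - 1) y = 2 * cos (n * (t + pi))\<close>.\<close>

lemma diagonal_gbinomial_difference:
  assumes n: "n \<ge> 1" and "cos t \<noteq> 0"
  shows "2 * (\<Sum>k = 0..(n + 1) div 2.
        ((2 * real k - real n - 1) gchoose k) * (- (2 * cos t)) powi (int n - 2 * int k))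
      - (\<Sum>k = 0..n div 2. ((2 * real k - real n) gchoose k) * (- (2 * cos t)) powi (int n - 2 * int k))
    = (- 1) ^ n * (2 * cos (real n * t))"
proof -
  obtain p where p: "n = Suc p" using n by (cases n) auto
  define y where "y = - (2 * cos t)"
  have "y \<noteq> 0" using assms by (simp add: y_def)
  have y: "y = 2 * cos (t + pi)" by (simp add: y_def)
  have "(\<Sum>k = 0..n div 2. ((2 * real k - real n) gchoose k) * y powi (int n - 2 * int k))
      = y * (\<Sum>k = 0..(p + 1) div 2. ((2 * real k - real p - 1) gchoose k) * y powi (int p - 2 * int k))"
    unfolding sum_distrib_left
  proof (rule sum.cong)
    fix k
    have "y powi (int n - 2 * int k) = y * y powi (int p - 2 * int k)"
      using power_int_add_1'[of y "int p - 2 * int k"] \<open>y \<noteq> 0\<close> by (simp add: p algebra_simps)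
    then show "((2 * real k - real n) gchoose k) * y powi (int n - 2 * int k)
        = y * (((2 * real k - real p - 1) gchoose k) * y powi (int p - 2 * int k))"
      by (simp add: p algebra_simps)
  qed (simp add: p)
  also have "\<dots> = y * cheb_S p y"
    by (simp only: diagonal_gbinomial_sum[OF \<open>y \<noteq> 0\<close>])
  finally have "2 * (\<Sum>k = 0..(n + 1) div 2.
        ((2 * real k - real n - 1) gchoose k) * y powi (int n - 2 * int k))
      - (\<Sum>k = 0..n div 2. ((2 * real k - real n) gchoose k) * y powi (int n - 2 * int k))
    = 2 * cheb_S n y - y * cheb_S p y"
    by (simp only: diagonal_gbinomial_sum[OF \<open>y \<noteq> 0\<close>])
  also have "\<dots> = 2 * cos (real n * (t + pi))"
    using cheb_S_cos[of p "t + pi"] unfolding y p .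
  also have "\<dots> = (- 1) ^ n * (2 * cos (real n * t))"
    by (simp add: distrib_left cos_add)
  finally show ?thesis unfolding y_def .
qed

lemma diagonal_sum_3:
  assumes "n \<ge> 1"
  shows "2 * (\<Sum>k = 0..(n + 1) div 2. (2 * real k - real n - 1) gchoose k)
      - (\<Sum>k = 0..n div 2. (2 * real k - real n) gchoose k)
    = (if \<not> 3 dvd n then (- 1) ^ (n - 1) else (- 1) ^ n * 2)"
proof -
  have y: "- (2 * cos (2 * pi / 3)) = 1"
    using cos_character_3[of 1] by simp
  then have "cos (2 * pi / 3) \<noteq> 0" by auto
  then have "2 * (\<Sum>k = 0..(n + 1) div 2. (2 * real k - real n - 1) gchoose k)
      - (\<Sum>k = 0..n div 2. (2 * real k - real n) gchoose k)
      = (- 1) ^ n * (2 * cos (real n * (2 * pi / 3)))"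
    using diagonal_gbinomial_difference[OF assms, of "2 * pi / 3"] unfolding y by simp
  also have "2 * cos (real n * (2 * pi / 3)) = (if 3 dvd n then 2 else - 1)"
    using cos_character_3[of "int n"] by (simp add: mult_ac int_dvd_int_iff[of 3 n, simplified])
  finally show ?thesis
    using assms by (cases n) auto
qed

lemma diagonal_sum_5:
  assumes "n \<ge> 1"
  shows "2 * (\<Sum>k = 0..(n + 1) div 2.
        ((2 * real k - real n - 1) gchoose k) * lucas (int n - 2 * int k))
      - (\<Sum>k = 0..n div 2. ((2 * real k - real n) gchoose k) * lucas (int n - 2 * int k))
    = (if \<not> 5 dvd n then (- 1) ^ (n - 1) else (- 1) ^ n * 4)"
proof -
  have "cos (2 * pi / 5) \<noteq> 0" "cos (4 * pi / 5) \<noteq> 0"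
    using cos_72_144 real_sqrt_gt_1_iff[of 5] by (auto simp del: real_sqrt_gt_1_iff)
  note diff = this[THEN diagonal_gbinomial_difference[OF assms]]
  have lucas: "lucas i = (- (2 * cos (2 * pi / 5))) powi i + (- (2 * cos (4 * pi / 5))) powi i" for i
    unfolding cos_72_144 by (simp add: lucas_def)
  have "2 * (\<Sum>k = 0..(n + 1) div 2.
        ((2 * real k - real n - 1) gchoose k) * lucas (int n - 2 * int k))
      - (\<Sum>k = 0..n div 2. ((2 * real k - real n) gchoose k) * lucas (int n - 2 * int k))
    = (- 1) ^ n * (2 * cos (real n * (2 * pi / 5))) + (- 1) ^ n * (2 * cos (real n * (4 * pi / 5)))"
    unfolding diff[symmetric] lucas distrib_left sum.distrib by linarith
  also have "\<dots> = (- 1) ^ n * (if 5 dvd n then 4 else - 1)"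
    unfolding distrib_left[symmetric]
    using cos_character_5[of "int n"] by (simp add: mult_ac int_dvd_int_iff[of 5 n, simplified])
  finally show ?thesis
    using assms by (cases n) auto
qed

theorem corollary19:
  shows
    "(\<forall>m::nat.
        3 / 2 * (\<Sum>k::int = - (int m div 3)..int m div 3.
                   real ((2 * m) choose nat (int m - 3 * k)))
          = 2 powi (2 * int m - 1) + 1
      \<and> 3 / 2 * (\<Sum>k::int = - ((int m + 2) div 3)..(int m - 1) div 3.
                   real ((2 * m + 1) choose nat (int m - 3 * k - 1)))
          = 3 * (\<Sum>k::int = 0..(int m - 1) div 3.
                   real ((2 * m + 1) choose nat (int m - 3 * k - 1)))
      \<and> 3 * (\<Sum>k::int = 0..(int m - 1) div 3.
                   real ((2 * m + 1) choose nat (int m - 3 * k - 1)))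
          = 4 ^ m - 1
      \<and> lucas (2 * int m)
          = - (2 powi (2 * int m - 1))
            + 5 / 2 * (\<Sum>k::int = - (int m div 5)..int m div 5.
                         real ((2 * m) choose nat (int m - 5 * k)))
      \<and> lucas (2 * int m + 1)
          = 4 ^ m
            - 5 / 2 * (\<Sum>k::int = - ((int m + 3) div 5)..(int m - 2) div 5.
                         real ((2 * m + 1) choose nat (int m - 5 * k - 2))))
   \<and> (\<forall>n::nat. n \<ge> 1 \<longrightarrow>
        2 * (\<Sum>k::nat = 0..(n + 1) div 2. (2 * real k - real n - 1) gchoose k)
          - (\<Sum>k::nat = 0..n div 2. (2 * real k - real n) gchoose k)
          = (if \<not> 3 dvd n then (- 1) ^ (n - 1) else (- 1) ^ n * 2)
      \<and> 2 * (\<Sum>k::nat = 0..(n + 1) div 2.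
               ((2 * real k - real n - 1) gchoose k) * lucas (int n - 2 * int k))
          - (\<Sum>k::nat = 0..n div 2.
               ((2 * real k - real n) gchoose k) * lucas (int n - 2 * int k))
          = (if \<not> 5 dvd n then (- 1) ^ (n - 1) else (- 1) ^ n * 4))"
proof (intro conjI allI impI)
  fix m :: nat
  let ?S = "\<lambda>A. \<Sum>k::int\<in>A. real ((2 * m + 1) choose nat (int m - 3 * k - 1))"
  show "3 / 2 * ?S {- ((int m + 2) div 3)..(int m - 1) div 3} = 3 * ?S {0..(int m - 1) div 3}"
    unfolding half_window_sum by simp
  then show "3 * ?S {0..(int m - 1) div 3} = 4 ^ m - 1"
    using window_sum_3_odd[of m] by (rule trans[OF sym])
qed (fact window_sum_3_even window_sum_5_even window_sum_5_odd diagonal_sum_3 diagonal_sum_5)+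

end
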